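(* Let $F$ be a field of characteristic not $2$, let $B$ be a central simple division algebra over $F$, let $\sigma\in\mathrm{Aut}_F(B)$ be a non-trivial automorphism and let $c\in B^{\times}$. Then there are exactly $2\,|J_F(c)\cap C(\sigma)|$ $F$-algebra automorphisms of $D(B,\sigma,c)$ (respectively of $D_r(B,\sigma,c)$), each of which is given by $$G(x,y)=(\tau(x),\tau(y)b_i)\qquad(x,y\in B)$$ for each $\tau\in J_F(c)\cap C(\sigma)$, where $b_1,b_2\in F$ are the two solutions in $F$ of $X^2-\tau(c)c^{-1}=0$, and $i=1,2$.
   Context: $D(B,\sigma,c)$ and $D_r(B,\sigma,c)$ denote the $F$-vector space $B\oplus B$ endowed, respectively, with the multiplications $(u,v)(x,y)=(ux+c\,\sigma(vy),\,uy+vx)$ and $(u,v)(x,y)=(ux+\sigma(vy)c,\,uy+vx)$, for $u,v,x,y\in B$. These are unital nonassociative $F$-algebras. $J_F(c)=\{\tau\in\mathrm{Aut}_F(B)\mid X^2-\tau(c)c^{-1}\text{ has solutions in }F\}$, a subgroup of $\mathrm{Aut}_F(B)$, and $C(\sigma)=\{\tau\in\mathrm{Aut}_F(B)\mid\tau\circ\sigma=\sigma\circ\tau\}$. Cardinalities may be infinite. *)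

theory Defs
  imports "HOL-Analysis.Analysis"
begin

locale assoc_algebra = vector_space smul
  for smul :: "'f::field \<Rightarrow> 'b::ring_1 \<Rightarrow> 'b" +
  assumes scale_mult_left: "smul a x * y = smul a (x * y)"
    and scale_mult_right: "x * smul a y = smul a (x * y)"

text \<open>The embedding of \<open>F\<close> into a unital \<open>F\<close>-algebra.\<close>

definition alg_of :: "('f \<Rightarrow> 'b::ring_1 \<Rightarrow> 'b) \<Rightarrow> 'f \<Rightarrow> 'b" where
  "alg_of smul a = smul a 1"

definition two_sided_ideal :: "'b::ring_1 set \<Rightarrow> bool" where
  "two_sided_ideal I \<longleftrightarrow>
     0 \<in> I \<and> (\<forall>x\<in>I. \<forall>y\<in>I. x - y \<in> I) \<and> (\<forall>r. \<forall>x\<in>I. r * x \<in> I \<and> x * r \<in> I)"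

text \<open>
  Finite dimensionality over \<open>F\<close>, which many authors include in ``central simple'', is
  deliberately not required here. A division algebra is an algebra on a type of class
  \<^class>\<open>division_ring\<close>.
\<close>

locale central_simple_algebra = assoc_algebra smul
  for smul :: "'f::field \<Rightarrow> 'b::ring_1 \<Rightarrow> 'b" +
  assumes central: "{z. \<forall>x. z * x = x * z} = range (alg_of smul)"
    and simple: "\<And>I :: 'b set. two_sided_ideal I \<Longrightarrow> I = {0} \<or> I = UNIV"

text \<open>
  Automorphisms of a not necessarily associative algebra with scalar multiplication \<open>smul\<close>
  and multiplication \<open>prd\<close>. If there is a unit, bijectivity forces it to be preserved.
\<close>

definition alg_aut ::
    "('f::field \<Rightarrow> 'a::ab_group_add \<Rightarrow> 'a) \<Rightarrow> ('a \<Rightarrow> 'a \<Rightarrow> 'a) \<Rightarrow> ('a \<Rightarrow> 'a) set" where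
  "alg_aut smul prd =
     {g. bij g \<and> Vector_Spaces.linear smul smul g \<and> (\<forall>x y. g (prd x y) = prd (g x) (g y))}"

text \<open>The algebras \<open>D(B,\<sigma>,c)\<close> and \<open>D\<^sub>r(B,\<sigma>,c)\<close> have underlying vector space \<open>B \<oplus> B\<close>,
  with scalar multiplication \<open>dscale\<close>.\<close>

definition dscale :: "('f::field \<Rightarrow> 'b::ab_group_add \<Rightarrow> 'b) \<Rightarrow> 'f \<Rightarrow> 'b \<times> 'b \<Rightarrow> 'b \<times> 'b" where
  "dscale smul = module_prod.scale smul smul"

definition D_mult :: "('b::ring_1 \<Rightarrow> 'b) \<Rightarrow> 'b \<Rightarrow> 'b \<times> 'b \<Rightarrow> 'b \<times> 'b \<Rightarrow> 'b \<times> 'b" where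
  "D_mult \<sigma> c = (\<lambda>(u, v) (x, y). (u * x + c * \<sigma> (v * y), u * y + v * x))"

definition Dr_mult :: "('b::ring_1 \<Rightarrow> 'b) \<Rightarrow> 'b \<Rightarrow> 'b \<times> 'b \<Rightarrow> 'b \<times> 'b \<Rightarrow> 'b \<times> 'b" where
  "Dr_mult \<sigma> c = (\<lambda>(u, v) (x, y). (u * x + \<sigma> (v * y) * c, u * y + v * x))"

text \<open>The solutions in \<open>F\<close> of \<open>X\<^sup>2 - \<tau>(c)c\<inverse> = 0\<close>, an equation in \<open>B\<close>.\<close>

definition sq_sols ::
    "('f::field \<Rightarrow> 'b::division_ring \<Rightarrow> 'b) \<Rightarrow> 'b \<Rightarrow> ('b \<Rightarrow> 'b) \<Rightarrow> 'f set" where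
  "sq_sols smul c \<tau> = {b. (alg_of smul b)\<^sup>2 - \<tau> c * inverse c = 0}"

definition J_grp ::
    "('f::field \<Rightarrow> 'b::division_ring \<Rightarrow> 'b) \<Rightarrow> 'b \<Rightarrow> ('b \<Rightarrow> 'b) set" where
  "J_grp smul c = {\<tau> \<in> alg_aut smul (*). sq_sols smul c \<tau> \<noteq> {}}"

definition C_grp ::
    "('f::field \<Rightarrow> 'b::ring_1 \<Rightarrow> 'b) \<Rightarrow> ('b \<Rightarrow> 'b) \<Rightarrow> ('b \<Rightarrow> 'b) set" where
  "C_grp smul \<sigma> = {\<tau> \<in> alg_aut smul (*). \<tau> \<circ> \<sigma> = \<sigma> \<circ> \<tau>}"

text \<open>The map \<open>G(x,y) = (\<tau>(x), \<tau>(y)b)\<close> for \<open>b \<in> F\<close>.\<close>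

definition G_map ::
    "('f::field \<Rightarrow> 'b::ring_1 \<Rightarrow> 'b) \<Rightarrow> ('b \<Rightarrow> 'b) \<Rightarrow> 'f \<Rightarrow> 'b \<times> 'b \<Rightarrow> 'b \<times> 'b" where
  "G_map smul \<tau> b = (\<lambda>(x, y). (\<tau> x, \<tau> y * alg_of smul b))"

unbundle cardinal_syntax

end

theory Submission
  imports Defs
begin

text \<open>
  Both multiplications have the form \<open>(u, v)(x, y) = (ux + P(vy), uy + vx)\<close>, where \<open>P\<close> is
  \<open>z \<mapsto> c \<sigma>(z)\<close> or \<open>z \<mapsto> \<sigma>(z) c\<close>. As \<open>\<sigma>\<close> is non-trivial, \<open>P\<close> is not both left and right
  \<open>B\<close>-linear, so that the middle nucleus is \<open>B \<oplus> 0\<close>. An automorphism \<open>g\<close> therefore restricts to an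
  automorphism \<open>\<tau>\<close> of \<open>B\<close>, and \<open>g(0, x) = (x', 0) g(0, 1) = g(0, 1) (x', 0)\<close> with \<open>x' = \<tau>(x)\<close>
  forces both components of \<open>g(0, 1)\<close> to be central. Since \<open>(0, 1)\<^sup>2 \<in> B \<oplus> 0\<close> and \<open>2 \<noteq> 0\<close>, one of
  these components vanishes, and it has to be the first one because \<open>g\<close> is bijective.
\<close>

section \<open>The doubled product and its middle nucleus\<close>

definition mid_nucleus :: "('a \<Rightarrow> 'a \<Rightarrow> 'a) \<Rightarrow> 'a set" where
  "mid_nucleus prd = {n. \<forall>p q. prd (prd p n) q = prd p (prd n q)}"

definition dickson_mult :: "('b::ring_1 \<Rightarrow> 'b) \<Rightarrow> 'b \<times> 'b \<Rightarrow> 'b \<times> 'b \<Rightarrow> 'b \<times> 'b" where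
  "dickson_mult P = (\<lambda>(u, v) (x, y). (u * x + P (v * y), u * y + v * x))"

lemma dickson_mult_simp [simp]:
  "dickson_mult P (u, v) (x, y) = (u * x + P (v * y), u * y + v * x)"
  by (simp add: dickson_mult_def)

lemma D_mult_eq: "D_mult \<sigma> c = dickson_mult (\<lambda>z. c * \<sigma> z)"
  by (simp add: D_mult_def dickson_mult_def)

lemma Dr_mult_eq: "Dr_mult \<sigma> c = dickson_mult (\<lambda>z. \<sigma> z * c)"
  by (simp add: Dr_mult_def dickson_mult_def)

lemma mid_nucleus_bij_hom:
  assumes hom: "\<And>x y. g (prd x y) = prd (g x) (g y)" and "bij g"
  shows "g n \<in> mid_nucleus prd \<longleftrightarrow> n \<in> mid_nucleus prd"
proof -
  have surj: "\<exists>p'. p = g p'" for p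
    using \<open>bij g\<close> by (meson bij_is_surj surjE)
  \<comment> \<open>Surjectivity of \<open>g\<close> lets the quantified \<open>p\<close>,
    \<open>q\<close> be replaced by \<open>g p\<close>, \<open>g q\<close>; injectivity then cancels
    an outer \<open>g\<close>.\<close>
  have "g n \<in> mid_nucleus prd \<longleftrightarrow>
    (\<forall>p q. prd (prd (g p) (g n)) (g q) = prd (g p) (prd (g n) (g q)))"
    unfolding mid_nucleus_def mem_Collect_eq by (metis surj)
  also have "\<dots> \<longleftrightarrow> (\<forall>p q. g (prd (prd p n) q) = g (prd p (prd n q)))"
    by (simp only: hom)
  also have "\<dots> \<longleftrightarrow> n \<in> mid_nucleus prd"
    using \<open>bij g\<close> by (simp add: mid_nucleus_def bij_is_inj inj_eq)
  finally show ?thesis .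
qed

text \<open>If \<open>n = (x, y)\<close> with \<open>y \<noteq> 0\<close>, associating
  \<open>n\<close> with one vector from each summand moves a factor out of \<open>P\<close>, on the
  left or on the right, and \<open>y\<close> is absorbed by its inverse; so \<open>P\<close> would
  be linear on both sides. For \<open>y = 0\<close>, both bracketings apply \<open>P\<close> to the
  same triple product.\<close>

lemma mid_nucleus_dickson_mult:
  fixes P :: "'b::division_ring \<Rightarrow> 'b"
  assumes P0: "P 0 = 0"
    and not_bilinear: "\<not> ((\<forall>u z. P (u * z) = u * P z) \<and> (\<forall>z s. P (z * s) = P z * s))"
  shows "n \<in> mid_nucleus (dickson_mult P) \<longleftrightarrow> snd n = 0"
proof
  assume n: "n \<in> mid_nucleus (dickson_mult P)"
  obtain x y where xy: "n = (x, y)" by fastforce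
  have assoc: "dickson_mult P (dickson_mult P p (x, y)) q = dickson_mult P p (dickson_mult P (x, y) q)"
    for p q using n unfolding mid_nucleus_def xy by blast
  show "snd n = 0"
  proof (rule ccontr)
    assume "snd n \<noteq> 0"
    then have y: "y \<noteq> 0" by (simp add: xy)
    have left: "P (u * z) = u * P z" for u z
    proof -
      \<comment> \<open>The first components give \<open>P (u * y * w) = u * P (y * w)\<close>; the
        choice \<open>w = inverse y * z\<close> eliminates \<open>y\<close>. The right-hand case is
        the mirror image.\<close>
      have "P (u * y * (inverse y * z)) = u * P (y * (inverse y * z))"
        using assoc[of "(u, 0)" "(0, inverse y * z)"] P0 by simp
      moreover have "y * (inverse y * z) = z"
        using y by (simp add: mult.assoc[symmetric])
      ultimately show ?thesis by (simp only: mult.assoc)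
    qed
    have right: "P (z * s) = P z * s" for z s
    proof -
      have "P (z * inverse y * (y * s)) = P (z * inverse y * y) * s"
        using assoc[of "(0, z * inverse y)" "(s, 0)"] P0 by simp
      moreover have "z * inverse y * (y * s) = z * s"
        using y by (metis mult.assoc left_inverse mult_1_right)
      moreover have "z * inverse y * y = z"
        using y by (simp add: mult.assoc)
      ultimately show ?thesis by simp
    qed
    show False using not_bilinear left right by blast
  qed
next
  assume "snd n = 0"
  then show "n \<in> mid_nucleus (dickson_mult P)"
    by (cases n) (auto simp: mid_nucleus_def dickson_mult_def P0 algebra_simps)
qed

lemma alg_autD:
  assumes "\<tau> \<in> alg_aut smul prd"
  shows "bij \<tau>" "\<tau> (x + y) = \<tau> x + \<tau> y" "\<tau> (smul a x) = smul a (\<tau> x)"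
    "\<tau> (prd x y) = prd (\<tau> x) (\<tau> y)"
  using assms by (auto simp: alg_aut_def Vector_Spaces.linear_iff)

lemma alg_aut_0:
  assumes "\<tau> \<in> alg_aut smul prd" shows "\<tau> 0 = 0"
  using alg_autD(2)[OF assms, of 0 0] by simp

lemma alg_aut_1:
  fixes \<tau> :: "'b::ring_1 \<Rightarrow> 'b"
  assumes "\<tau> \<in> alg_aut smul (*)" shows "\<tau> 1 = 1"
proof -
  \<comment> \<open>With this \<open>e\<close>, multiplicativity on \<open>1 * e\<close> reads
    \<open>1 = \<tau> 1 * 1\<close>.\<close>
  obtain e where e: "\<tau> e = 1"
    using alg_autD(1)[OF assms] by (metis bij_is_surj surjE)
  show ?thesis using alg_autD(4)[OF assms, of 1 e] e by simp
qed

section \<open>Scalars and square roots in a central division algebra\<close>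

locale central_division_algebra = central_simple_algebra smul
  for smul :: "'f::field \<Rightarrow> 'b::division_ring \<Rightarrow> 'b"
begin

lemma alg_of_mult [simp]: "alg_of smul a * x = smul a x"
  by (simp add: alg_of_def scale_mult_left)

lemma mult_alg_of [simp]: "x * alg_of smul a = smul a x"
  by (simp add: alg_of_def scale_mult_right)

lemma central_eq_alg_of:
  assumes "\<And>x. z * x = x * z" obtains a where "z = alg_of smul a"
proof -
  have "z \<in> range (alg_of smul)" using assms unfolding central[symmetric] by blast
  then show ?thesis using that by blast
qed

lemma vector_space_smul: "vector_space smul"
  by unfold_locales

sublocale prod: vector_space_prod smul smul ..

lemma dscale_simp [simp]: "dscale smul a (x, y) = (smul a x, smul a y)"
  by (simp add: dscale_def prod.scale_prod)

lemma vector_space_dscale: "vector_space (dscale smul)"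
  unfolding dscale_def by (rule prod.p.vector_space_axioms)

lemma G_map_simp [simp]: "G_map smul \<tau> b (x, y) = (\<tau> x, smul b (\<tau> y))"
  by (simp add: G_map_def)

lemma G_map_inject:
  assumes "\<tau> \<in> alg_aut smul (*)" "\<tau>' \<in> alg_aut smul (*)"
    and eq: "G_map smul \<tau> b = G_map smul \<tau>' b'"
  shows "\<tau> = \<tau>' \<and> b = b'"
proof
  show "\<tau> = \<tau>'" using fun_cong[OF eq, of "(x, 0)" for x] by (intro ext) simp
  show "b = b'"
    using fun_cong[OF eq, of "(0, 1)"] assms(1,2)[THEN alg_aut_1] by simp
qed

lemma two_neq_0:
  assumes "CHAR('f) \<noteq> 2" shows "(2::'f) \<noteq> 0"
proof
  assume "(2::'f) = 0"
  then have "of_nat 2 = (0::'f)" by simp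
  then have "CHAR('f) dvd 2" by (simp only: of_nat_eq_0_iff_char_dvd)
  then have "CHAR('f) \<le> 2" "CHAR('f) > 0"
    by (simp_all add: dvd_imp_le dvd_pos_nat[of 2])
  then show False using assms CHAR_not_1[where 'a='f] by linarith
qed

text \<open>Multiplying by \<open>c\<close> on the right clears the inverse. In this form the scalar
  \<open>b\<^sup>2\<close> can be moved freely through products.\<close>

lemma in_sq_sols_iff:
  assumes "c \<noteq> 0"
  shows "b \<in> sq_sols smul c \<tau> \<longleftrightarrow> \<tau> c = smul (b\<^sup>2) c"
proof -
  have "b \<in> sq_sols smul c \<tau> \<longleftrightarrow> \<tau> c * inverse c = alg_of smul (b\<^sup>2)"
    by (auto simp: sq_sols_def power2_eq_square alg_of_def scale_mult_left)
  also have "\<dots> \<longleftrightarrow> \<tau> c = alg_of smul (b\<^sup>2) * c"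
    using assms by (metis divide_inverse eq_divide_eq)
  finally show ?thesis by simp
qed

text \<open>Cancelling the nonzero vector \<open>c\<close> leaves an equality of two squares in the
  field F.\<close>

lemma sq_sols_pair:
  assumes c: "c \<noteq> 0" and b: "b \<in> sq_sols smul c \<tau>"
  shows "sq_sols smul c \<tau> = {b, - b}"
  using b by (auto simp: in_sq_sols_iff[OF c] c power2_eq_iff)

text \<open>Otherwise \<open>2 * b = 0\<close>, so \<open>b = 0\<close> and
  \<open>\<tau> c = 0\<close>, against injectivity. This gives both that the two roots are distinct
  and that every root is nonzero.\<close>

lemma sq_sols_neq_uminus:
  assumes char: "CHAR('f) \<noteq> 2" and c: "c \<noteq> 0"
    and \<tau>: "\<tau> \<in> alg_aut smul (*)" and b: "b \<in> sq_sols smul c \<tau>"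
  shows "b \<noteq> - b"
proof
  assume "b = - b"
  then have "2 * b = 0" by (simp only: mult_2 eq_neg_iff_add_eq_0)
  then have "b = 0" using two_neq_0[OF char] by simp
  then have "\<tau> c = \<tau> 0"
    using b alg_aut_0[OF \<tau>] by (simp add: in_sq_sols_iff[OF c])
  then show False using c bij_is_inj[OF alg_autD(1)[OF \<tau>]] by (simp add: inj_eq)
qed

section \<open>Automorphisms of the doubled algebra\<close>

lemma G_map_alg_aut:
  assumes \<tau>: "\<tau> \<in> alg_aut smul (*)" and b: "b \<noteq> 0"
    and P_smul: "\<And>a z. P (smul a z) = smul a (P z)"
    and comm: "\<And>z. \<tau> (P z) = smul (b\<^sup>2) (P (\<tau> z))"
  shows "G_map smul \<tau> b \<in> alg_aut (dscale smul) (dickson_mult P)"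
proof -
  note \<tau>s = alg_autD[OF \<tau>]
  have inj: "inj (G_map smul \<tau> b)"
    using bij_is_inj[OF \<tau>s(1)] b by (auto simp: inj_on_def)
  have "p \<in> range (G_map smul \<tau> b)" for p
  proof -
    obtain x y where "p = (x, y)" by fastforce
    moreover obtain x' where "\<tau> x' = x" using \<tau>s(1) by (metis bij_is_surj surjE)
    moreover obtain y' where "\<tau> y' = smul (inverse b) y" using \<tau>s(1) by (metis bij_is_surj surjE)
    ultimately have "p = G_map smul \<tau> b (x', y')" using b by simp
    then show ?thesis by blast
  qed
  then have "bij (G_map smul \<tau> b)" using inj by (auto simp: bij_def)
  moreover have "Vector_Spaces.linear (dscale smul) (dscale smul) (G_map smul \<tau> b)"
    by (auto simp: Vector_Spaces.linear_iff vector_space_dscale \<tau>s scale_right_distrib mult.commute)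
  \<comment> \<open>The argument of \<open>P\<close> picks up a factor \<open>b\<close> from each of
    the two vectors, which is the \<open>b\<^sup>2\<close> of \<open>comm\<close>; the second
    component carries a single \<open>b\<close>, a scalar.\<close>
  moreover have "G_map smul \<tau> b (dickson_mult P p q) =
      dickson_mult P (G_map smul \<tau> b p) (G_map smul \<tau> b q)" for p q
    by (cases p; cases q)
      (simp add: \<tau>s comm P_smul scale_mult_left scale_mult_right scale_right_distrib power2_eq_square)
  ultimately show ?thesis unfolding alg_aut_def by blast
qed

lemma alg_aut_dickson_mult_cases:
  assumes char: "CHAR('f) \<noteq> 2"
    and P_smul: "\<And>a z. P (smul a z) = smul a (P z)"
    and not_bilinear: "\<not> ((\<forall>u z. P (u * z) = u * P z) \<and> (\<forall>z s. P (z * s) = P z * s))"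
    and g: "g \<in> alg_aut (dscale smul) (dickson_mult P)"
  obtains \<tau> b where "\<tau> \<in> alg_aut smul (*)" "b \<noteq> 0" "\<And>z. \<tau> (P z) = smul (b\<^sup>2) (P (\<tau> z))"
    "g = G_map smul \<tau> b"
proof -
  note gs = alg_autD[OF g]
  have P0: "P 0 = 0" using P_smul[of 0 0] by simp
  \<comment> \<open>As the middle nucleus, B \<oplus> 0 is preserved by \<open>g\<close> in both
    directions: one makes \<open>\<tau>\<close> well defined, the other makes it surjective.\<close>
  have nuc: "snd (g p) = 0 \<longleftrightarrow> snd p = 0" for p
    using mid_nucleus_bij_hom[of g "dickson_mult P" p] gs
    by (simp add: mid_nucleus_dickson_mult[of P, OF P0 not_bilinear])
  define \<tau> where "\<tau> x = fst (g (x, 0))" for x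
  have g_fst: "g (x, 0) = (\<tau> x, 0)" for x
    using nuc[of "(x, 0)"] by (simp add: \<tau>_def prod_eq_iff)
  have \<tau>_add: "\<tau> (x + y) = \<tau> x + \<tau> y" for x y
    using gs(2)[of "(x, 0)" "(y, 0)"] by (simp add: g_fst)
  have \<tau>_smul: "\<tau> (smul a x) = smul a (\<tau> x)" for a x
    using gs(3)[of a "(x, 0)"] by (simp add: g_fst)
  have \<tau>_mult: "\<tau> (x * y) = \<tau> x * \<tau> y" for x y
    using gs(4)[of "(x, 0)" "(y, 0)"] by (simp add: g_fst P0)
  have "inj \<tau>"
  proof (rule injI)
    fix x y assume "\<tau> x = \<tau> y"
    then have "g (x, 0) = g (y, 0)" by (simp add: g_fst)
    then show "x = y" using bij_is_inj[OF gs(1)] by (simp add: inj_eq)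
  qed
  moreover have surj: "\<exists>x. \<tau> x = y" for y
  proof -
    obtain p where p: "g p = (y, 0)" using gs(1) by (metis bij_is_surj surjE)
    then have "p = (fst p, 0)" using nuc[of p] by (simp add: prod_eq_iff)
    then have "\<tau> (fst p) = y" using p by (metis \<tau>_def fst_conv)
    then show ?thesis by blast
  qed
  ultimately have \<tau>: "\<tau> \<in> alg_aut smul (*)"
    using \<tau>_add \<tau>_smul \<tau>_mult
    by (auto simp: alg_aut_def Vector_Spaces.linear_iff vector_space_smul bij_def) (metis rangeI)
  obtain \<alpha> \<beta> where \<alpha>\<beta>: "g (0, 1) = (\<alpha>, \<beta>)" by fastforce
  \<comment> \<open>Both formulas come from \<open>(x, 0)(0, 1) = (0, x) = (0, 1)(x, 0)\<close>.
    Comparing them, with \<open>\<tau>\<close> surjective, makes \<open>\<alpha>\<close> and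
    \<open>\<beta>\<close> central.\<close>
  have g_snd: "g (0, x) = (\<tau> x * \<alpha>, \<tau> x * \<beta>)" "g (0, x) = (\<alpha> * \<tau> x, \<beta> * \<tau> x)" for x
    using gs(4)[of "(x, 0)" "(0, 1)"] gs(4)[of "(0, 1)" "(x, 0)"] by (simp_all add: g_fst \<alpha>\<beta> P0)
  have comm: "\<alpha> * y = y * \<alpha>" "\<beta> * y = y * \<beta>" for y
    using surj[of y] g_snd by auto
  obtain a where a: "\<alpha> = alg_of smul a" using comm(1) central_eq_alg_of by blast
  obtain b where b: "\<beta> = alg_of smul b" using comm(2) central_eq_alg_of by blast
  have b0: "b \<noteq> 0"
  proof
    assume "b = 0"
    then have "snd (g (0, 1)) = 0" by (simp add: \<alpha>\<beta> b alg_of_def)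
    then show False by (simp add: nuc)
  qed
  have "g (P 1, 0) = dickson_mult P (\<alpha>, \<beta>) (\<alpha>, \<beta>)"
    using gs(4)[of "(0, 1)" "(0, 1)"] by (simp add: \<alpha>\<beta>)
  \<comment> \<open>This is the second component: the left side has none, and the right side has
    \<open>\<alpha> * \<beta> + \<beta> * \<alpha>\<close>.\<close>
  then have "smul (a * b) 1 + smul (a * b) 1 = 0"
    by (simp add: g_fst a b) (simp add: alg_of_def mult.commute)
  then have "smul (2 * (a * b)) 1 = 0" by (simp only: mult_2 scale_left_distrib)
  then have a0: "a = 0" using b0 two_neq_0[OF char] by simp
  have g_G: "g = G_map smul \<tau> b"
  proof
    fix p :: "'b \<times> 'b"
    obtain x y where p: "p = (x, y)" by fastforce
    have "g p = g (x, 0) + g (0, y)" using gs(2)[of "(x, 0)" "(0, y)"] by (simp add: p)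
    then show "g p = G_map smul \<tau> b p" by (simp add: p g_fst g_snd(1) a b a0)
  qed
  \<comment> \<open>Apply \<open>g\<close> to \<open>(0, z)(0, 1) = (P z, 0)\<close>.\<close>
  have "\<tau> (P z) = smul (b\<^sup>2) (P (\<tau> z))" for z
    using gs(4)[of "(0, z)" "(0, 1)"]
    by (simp add: g_G alg_aut_0[OF \<tau>] alg_aut_1[OF \<tau>] scale_mult_left scale_mult_right P_smul
        power2_eq_square)
  then show thesis using that \<tau> b0 g_G by blast
qed

text \<open>The premise \<open>comm\<close> isolates what depends on the shape of \<open>P\<close>:
  it translates compatibility with the product into the root condition and commutation with
  \<open>\<sigma>\<close>. One argument thus serves both algebras.\<close>

lemma bij_betw_G_map:
  assumes char: "CHAR('f) \<noteq> 2" and c: "c \<noteq> 0"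
    and P_smul: "\<And>a z. P (smul a z) = smul a (P z)"
    and not_bilinear: "\<not> ((\<forall>u z. P (u * z) = u * P z) \<and> (\<forall>z s. P (z * s) = P z * s))"
    and comm: "\<And>\<tau> b. \<tau> \<in> alg_aut smul (*) \<Longrightarrow>
      (\<forall>z. \<tau> (P z) = smul (b\<^sup>2) (P (\<tau> z))) \<longleftrightarrow> \<tau> c = smul (b\<^sup>2) c \<and> \<tau> \<circ> \<sigma> = \<sigma> \<circ> \<tau>"
  shows "bij_betw (\<lambda>(\<tau>, b). G_map smul \<tau> b)
           (SIGMA \<tau> : J_grp smul c \<inter> C_grp smul \<sigma>. sq_sols smul c \<tau>)
           (alg_aut (dscale smul) (dickson_mult P))"
proof -
  let ?S = "SIGMA \<tau> : J_grp smul c \<inter> C_grp smul \<sigma>. sq_sols smul c \<tau>"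
  have S: "(\<tau>, b) \<in> ?S \<longleftrightarrow> \<tau> \<in> alg_aut smul (*) \<and> (\<forall>z. \<tau> (P z) = smul (b\<^sup>2) (P (\<tau> z)))" for \<tau> b
    using comm[of \<tau> b] by (auto simp: J_grp_def C_grp_def in_sq_sols_iff[OF c])
  have "G_map smul \<tau> b \<in> alg_aut (dscale smul) (dickson_mult P)" if \<tau>b: "(\<tau>, b) \<in> ?S" for \<tau> b
  proof (rule G_map_alg_aut)
    show \<tau>: "\<tau> \<in> alg_aut smul (*)" using \<tau>b S by blast
    \<comment> \<open>A zero root would equal its own negative.\<close>
    show "b \<noteq> 0"
      using sq_sols_neq_uminus[OF char c \<tau>, of b] \<tau>b by auto
  qed (use \<tau>b S P_smul in blast)+
  moreover have "\<exists>\<tau> b. (\<tau>, b) \<in> ?S \<and> g = G_map smul \<tau> b"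
    if "g \<in> alg_aut (dscale smul) (dickson_mult P)" for g
    using alg_aut_dickson_mult_cases[OF char P_smul not_bilinear that] S by metis
  ultimately have "(\<lambda>(\<tau>, b). G_map smul \<tau> b) ` ?S = alg_aut (dscale smul) (dickson_mult P)"
    by force
  moreover have "inj_on (\<lambda>(\<tau>, b). G_map smul \<tau> b) ?S"
  proof (rule inj_onI, unfold split_paired_all prod.case prod.inject)
    fix \<tau> b \<tau>' b'
    assume "(\<tau>, b) \<in> ?S" "(\<tau>', b') \<in> ?S" and eq: "G_map smul \<tau> b = G_map smul \<tau>' b'"
    then show "\<tau> = \<tau>' \<and> b = b'" using S G_map_inject[OF _ _ eq] by blast
  qed
  ultimately show ?thesis by (simp add: bij_betw_def)
qed

section \<open>The two twists \<open>c * \<sigma> z\<close> and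
  \<open>\<sigma> z * c\<close>\<close>

lemma twist_comm_iff:
  assumes c: "c \<noteq> 0" and \<sigma>: "\<sigma> \<in> alg_aut smul (*)" and \<tau>: "\<tau> \<in> alg_aut smul (*)"
  shows "(\<forall>z. \<tau> (c * \<sigma> z) = smul (b\<^sup>2) (c * \<sigma> (\<tau> z))) \<longleftrightarrow> \<tau> c = smul (b\<^sup>2) c \<and> \<tau> \<circ> \<sigma> = \<sigma> \<circ> \<tau>"
    and "(\<forall>z. \<tau> (\<sigma> z * c) = smul (b\<^sup>2) (\<sigma> (\<tau> z) * c)) \<longleftrightarrow> \<tau> c = smul (b\<^sup>2) c \<and> \<tau> \<circ> \<sigma> = \<sigma> \<circ> \<tau>"
proof -
  have \<tau>c: "\<tau> c \<noteq> 0"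
    using c alg_aut_0[OF \<tau>] bij_is_inj[OF alg_autD(1)[OF \<tau>]] by (metis injD)
  have left: "\<tau> (c * \<sigma> z) = smul (b\<^sup>2) (c * \<sigma> (\<tau> z)) \<longleftrightarrow> \<tau> (\<sigma> z) = \<sigma> (\<tau> z)"
    and right: "\<tau> (\<sigma> z * c) = smul (b\<^sup>2) (\<sigma> (\<tau> z) * c) \<longleftrightarrow> \<tau> (\<sigma> z) = \<sigma> (\<tau> z)"
    if "\<tau> c = smul (b\<^sup>2) c" for z
  proof -
    \<comment> \<open>The scalar is absorbed into \<open>c\<close>, on whichever side
      \<open>c\<close> stands, so that the nonzero factor \<open>\<tau> c\<close> cancels.\<close>
    have "smul (b\<^sup>2) (c * w) = \<tau> c * w" "smul (b\<^sup>2) (w * c) = w * \<tau> c" for w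
      by (simp_all add: that scale_mult_left scale_mult_right)
    then show "\<tau> (c * \<sigma> z) = smul (b\<^sup>2) (c * \<sigma> (\<tau> z)) \<longleftrightarrow> \<tau> (\<sigma> z) = \<sigma> (\<tau> z)"
      and "\<tau> (\<sigma> z * c) = smul (b\<^sup>2) (\<sigma> (\<tau> z) * c) \<longleftrightarrow> \<tau> (\<sigma> z) = \<sigma> (\<tau> z)"
      using \<tau>c by (simp_all only: alg_autD(4)[OF \<tau>] mult_cancel_left mult_cancel_right) simp_all
  qed
  \<comment> \<open>At \<open>z = 1\<close> the twist disappears, because \<open>\<sigma>\<close>
    and \<open>\<tau>\<close> fix \<open>1\<close>.\<close>
  have "\<tau> c = smul (b\<^sup>2) c" if "\<forall>z. \<tau> (c * \<sigma> z) = smul (b\<^sup>2) (c * \<sigma> (\<tau> z))"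
    using spec[OF that, of 1] by (simp add: alg_aut_1[OF \<sigma>] alg_aut_1[OF \<tau>])
  then show "(\<forall>z. \<tau> (c * \<sigma> z) = smul (b\<^sup>2) (c * \<sigma> (\<tau> z))) \<longleftrightarrow>
      \<tau> c = smul (b\<^sup>2) c \<and> \<tau> \<circ> \<sigma> = \<sigma> \<circ> \<tau>"
    unfolding fun_eq_iff comp_def using left by blast
  have "\<tau> c = smul (b\<^sup>2) c" if "\<forall>z. \<tau> (\<sigma> z * c) = smul (b\<^sup>2) (\<sigma> (\<tau> z) * c)"
    using spec[OF that, of 1] by (simp add: alg_aut_1[OF \<sigma>] alg_aut_1[OF \<tau>])
  then show "(\<forall>z. \<tau> (\<sigma> z * c) = smul (b\<^sup>2) (\<sigma> (\<tau> z) * c)) \<longleftrightarrow>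
      \<tau> c = smul (b\<^sup>2) c \<and> \<tau> \<circ> \<sigma> = \<sigma> \<circ> \<tau>"
    unfolding fun_eq_iff comp_def using right by blast
qed

lemma twist_not_bilinear:
  assumes c: "c \<noteq> 0" and \<sigma>: "\<sigma> \<in> alg_aut smul (*)" "\<sigma> \<noteq> id"
  shows "\<not> ((\<forall>u z. c * \<sigma> (u * z) = u * (c * \<sigma> z)) \<and> (\<forall>z s. c * \<sigma> (z * s) = c * \<sigma> z * s))"
    and "\<not> ((\<forall>u z. \<sigma> (u * z) * c = u * (\<sigma> z * c)) \<and> (\<forall>z s. \<sigma> (z * s) * c = \<sigma> z * c * s))"
proof -
  obtain z where z: "\<sigma> z \<noteq> z" using \<sigma>(2) by (auto simp: fun_eq_iff)
  \<comment> \<open>Right linearity of the first twist, or left linearity of the second, taken at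
    \<open>1\<close>, would force \<open>\<sigma> z = z\<close>.\<close>
  have "c * \<sigma> (1 * z) \<noteq> c * \<sigma> 1 * z" "\<sigma> (z * 1) * c \<noteq> z * (\<sigma> 1 * c)"
    using z c by (simp_all add: alg_aut_1[OF \<sigma>(1)])
  then show "\<not> ((\<forall>u z. c * \<sigma> (u * z) = u * (c * \<sigma> z)) \<and> (\<forall>z s. c * \<sigma> (z * s) = c * \<sigma> z * s))"
    and "\<not> ((\<forall>u z. \<sigma> (u * z) * c = u * (\<sigma> z * c)) \<and> (\<forall>z s. \<sigma> (z * s) * c = \<sigma> z * c * s))"
    by blast+
qed

end

section \<open>Counting, with possibly infinite cardinals\<close>

lemma card_of_Sigma_two:
  assumes "\<And>x. x \<in> A \<Longrightarrow> card (B x) = 2"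
  shows "|SIGMA x : A. B x| =o ctwo *c |A|"
proof -
  \<comment> \<open>Each fibre is identified with \<open>bool\<close>, whose cardinality is
    \<open>ctwo\<close>; choosing such identifications turns the disjoint union into a
    product.\<close>
  have "\<exists>f. bij_betw f (B x) (UNIV :: bool set)" if "x \<in> A" for x
    by (rule finite_same_card_bij) (use assms[OF that] in \<open>auto intro: card_ge_0_finite\<close>)
  then obtain f where f: "\<And>x. x \<in> A \<Longrightarrow> bij_betw (f x) (B x) (UNIV :: bool set)" by metis
  have "bij_betw (\<lambda>(x, y). (f x y, x)) (SIGMA x : A. B x) ((UNIV :: bool set) \<times> A)"
    unfolding bij_betw_def
  proof
    show "inj_on (\<lambda>(x, y). (f x y, x)) (SIGMA x : A. B x)"
      using f by (auto simp: inj_on_def bij_betw_def)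
    show "(\<lambda>(x, y). (f x y, x)) ` (SIGMA x : A. B x) = (UNIV :: bool set) \<times> A"
    proof (intro equalityI subsetI)
      fix p assume "p \<in> (UNIV :: bool set) \<times> A"
      then obtain e x where p: "p = (e, x)" "x \<in> A" by blast
      then obtain y where "y \<in> B x" "f x y = e"
        using f[of x] by (metis UNIV_I bij_betw_imp_surj_on imageE)
      then show "p \<in> (\<lambda>(x, y). (f x y, x)) ` (SIGMA x : A. B x)" using p by force
    qed auto
  qed
  then show ?thesis
    unfolding cprod_def ctwo_def Field_card_of using card_of_ordIso by blast
qed

theorem theorem3p20:
  fixes smul :: "'f::field \<Rightarrow> 'b::division_ring \<Rightarrow> 'b"
    and \<sigma> :: "'b \<Rightarrow> 'b" and c :: 'b
  assumes "CHAR('f) \<noteq> 2"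
    and "central_simple_algebra smul"
    and "\<sigma> \<in> alg_aut smul (*)" and "\<sigma> \<noteq> id"
    and "c \<noteq> 0"
  shows "(\<forall>\<tau> \<in> J_grp smul c \<inter> C_grp smul \<sigma>. card (sq_sols smul c \<tau>) = 2) \<and>
         |alg_aut (dscale smul) (D_mult \<sigma> c)| =o ctwo *c |J_grp smul c \<inter> C_grp smul \<sigma>| \<and>
         bij_betw (\<lambda>(\<tau>, b). G_map smul \<tau> b)
           (SIGMA \<tau> : J_grp smul c \<inter> C_grp smul \<sigma>. sq_sols smul c \<tau>)
           (alg_aut (dscale smul) (D_mult \<sigma> c)) \<and>
         |alg_aut (dscale smul) (Dr_mult \<sigma> c)| =o ctwo *c |J_grp smul c \<inter> C_grp smul \<sigma>| \<and>
         bij_betw (\<lambda>(\<tau>, b). G_map smul \<tau> b)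
           (SIGMA \<tau> : J_grp smul c \<inter> C_grp smul \<sigma>. sq_sols smul c \<tau>)
           (alg_aut (dscale smul) (Dr_mult \<sigma> c))"
proof -
  interpret central_division_algebra smul
    using assms(2) by (simp add: central_division_algebra_def)
  note \<sigma> = assms(3,4) and c = assms(5)
  have card: "card (sq_sols smul c \<tau>) = 2" if \<tau>: "\<tau> \<in> J_grp smul c \<inter> C_grp smul \<sigma>" for \<tau>
  proof -
    obtain b where b: "b \<in> sq_sols smul c \<tau>" and aut: "\<tau> \<in> alg_aut smul (*)"
      using \<tau> by (auto simp: J_grp_def)
    show ?thesis
      using sq_sols_neq_uminus[OF assms(1) c aut b] by (simp add: sq_sols_pair[OF c b])
  qed
  have D: "bij_betw (\<lambda>(\<tau>, b). G_map smul \<tau> b)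
      (SIGMA \<tau> : J_grp smul c \<inter> C_grp smul \<sigma>. sq_sols smul c \<tau>)
      (alg_aut (dscale smul) (D_mult \<sigma> c))"
    unfolding D_mult_eq
    by (rule bij_betw_G_map[OF assms(1) c _ twist_not_bilinear(1)[OF c \<sigma>]
          twist_comm_iff(1)[OF c \<sigma>(1)]])
      (simp add: alg_autD(3)[OF \<sigma>(1)] scale_mult_right)
  have Dr: "bij_betw (\<lambda>(\<tau>, b). G_map smul \<tau> b)
      (SIGMA \<tau> : J_grp smul c \<inter> C_grp smul \<sigma>. sq_sols smul c \<tau>)
      (alg_aut (dscale smul) (Dr_mult \<sigma> c))"
    unfolding Dr_mult_eq
    by (rule bij_betw_G_map[OF assms(1) c _ twist_not_bilinear(2)[OF c \<sigma>]
          twist_comm_iff(2)[OF c \<sigma>(1)]])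
      (simp add: alg_autD(3)[OF \<sigma>(1)] scale_mult_left)
  \<comment> \<open>Any set parametrised by the pairs \<open>(\<tau>, b)\<close> is a union of
    two-element fibres over the admissible \<open>\<tau>\<close>.\<close>
  have count: "|X| =o ctwo *c |J_grp smul c \<inter> C_grp smul \<sigma>|"
    if "bij_betw f (SIGMA \<tau> : J_grp smul c \<inter> C_grp smul \<sigma>. sq_sols smul c \<tau>) X"
    for f and X :: "('b \<times> 'b \<Rightarrow> 'b \<times> 'b) set"
    using card_of_ordIsoI[OF that, THEN ordIso_symmetric] card_of_Sigma_two[OF card]
    by (rule ordIso_transitive)
  show ?thesis by (intro conjI ballI card D Dr count[OF D] count[OF Dr])
qed

end
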